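(* For every abelian group $G$ and every endomorphism $f\colon G\to G$, $$\widetilde{\mathrm{ent}}(f)=\widetilde h\big((\mathcal S^{\vee}(G),d_{[\,:]}),\mathcal S^{\vee}(f)\big).$$ That is, on the category of flows of abelian groups, the intrinsic algebraic entropy $\widetilde{\mathrm{ent}}$ coincides with the intrinsic functorial entropy $\widetilde h\circ\overline{\mathcal S}^{\vee}$, where $\overline{\mathcal S}^{\vee}(G,f)=(\mathcal S^{\vee}(G),\mathcal S^{\vee}(f))$.
   Context: A generalized quasimetric on a non-empty set $S$ is a function $d\colon S\times S\to\mathbb R_{\ge0}\cup\{\infty\}$ with (QM1) $d(x,y)=d(y,x)=0$ if and only if $x=y$, and (QM2) $d(x,z)\le d(x,y)+d(y,z)$ for all $x,y,z$. It induces the partial order $x\le y\iff d(y,x)=0$. The category $\mathcal L_{qm}$ has as objects the pairs $(S,d)$ such that $d$ is a generalized quasimetric, $(S,\le)$ is a join-semilattice (join written $+$) with bottom element $0$, and (QM3) $d(x,y)=d(x,x+y)$ for all $x,y$; its morphisms are the maps $\phi\colon (S,d)\to(S',d')$ with $\phi(x+y)=\phi(x)+\phi(y)$, $\phi(0)=0$ and $d'(\phi(x),\phi(y))\le d(x,y)$ for all $x,y$. A flow of a category is a pair consisting of an object and an endomorphism of it. For a flow $((S,d),\phi)$ of $\mathcal L_{qm}$, $x\in S$ is $\phi$-inert if $d(x,\phi(x))<\infty$; $\mathcal I_\phi(S)$ is the set of $\phi$-inert elements; $T_n(\phi,x)=x+\phi(x)+\dots+\phi^{n-1}(x)$ for $n\ge1$.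 For $x\in\mathcal I_\phi(S)$ put $\widetilde h(\phi,x)=\lim_{n\to\infty}\frac{d(x,T_n(\phi,x))}{n}$ (this limit exists), and $\widetilde h(S,\phi)=\widetilde h(\phi)=\sup\{\widetilde h(\phi,x)\mid x\in\mathcal I_\phi(S)\}\in\mathbb R_{\ge0}\cup\{\infty\}$. For an abelian group $G$, $\mathcal S^{\vee}(G)$ is the set of all subgroups of $G$ ordered by inclusion, with join $H+H'$ and bottom element the trivial subgroup, and with generalized quasimetric $d_{[\,:]}(H,H')=\log[H+H':H]$ (equal to $\infty$ if the index is infinite); it is an object of $\mathcal L_{qm}$. For a homomorphism $f\colon G\to G'$ of abelian groups, $\mathcal S^{\vee}(f)\colon\mathcal S^\vee(G)\to\mathcal S^\vee(G')$ is $H\mapsto f(H)$; this gives a functor from abelian groups to $\mathcal L_{qm}$, and $\overline{\mathcal S}^{\vee}$ is the induced functor on flows. Intrinsic algebraic entropy: for an endomorphism $f$ of an abelian group $G$, a subgroup $H$ of $G$ is $f$-inert if $(H+f(H))/H$ is finite; $\mathcal I_f(G)$ is the family of $f$-inert subgroups. For $H\in\mathcal I_f(G)$, $$\widetilde{\mathrm{ent}}(f,H)=\lim_{n\to\infty}\frac1n\log\left|\frac{H+f(H)+\cdots+f^{n-1}(H)}{H}\right|,$$ and $\widetilde{\mathrm{ent}}(f)=\sup\{\widetilde{\mathrm{ent}}(f,H)\mid H\in\mathcal I_f(G)\}$. *)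

theory Defs
  imports "HOL-Analysis.Analysis" "HOL-Algebra.Coset" "HOL-Algebra.Lattice"
begin

section \<open>Generalized quasimetric semilattices\<close>

record 'a qmspace = "'a partial_object" +
  qdist :: "'a \<Rightarrow> 'a \<Rightarrow> ennreal"

locale gen_quasimetric =
  fixes S :: "('a, 'b) qmspace_scheme"
  assumes nonempty: "carrier S \<noteq> {}"
    and QM1: "\<lbrakk>x \<in> carrier S; y \<in> carrier S\<rbrakk> \<Longrightarrow>
      (qdist S x y = 0 \<and> qdist S y x = 0) \<longleftrightarrow> x = y"
    and QM2: "\<lbrakk>x \<in> carrier S; y \<in> carrier S; z \<in> carrier S\<rbrakk> \<Longrightarrow>
      qdist S x z \<le> qdist S x y + qdist S y z"

text \<open>Join and bottom element are not part of the data of an object: they are those of the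
  partial order induced by the quasimetric.\<close>

definition qm_order :: "('a, 'b) qmspace_scheme \<Rightarrow> 'a gorder" where
  "qm_order S = \<lparr>carrier = carrier S, eq = (=), le = (\<lambda>x y. qdist S y x = 0)\<rparr>"

abbreviation qm_join :: "('a, 'b) qmspace_scheme \<Rightarrow> 'a \<Rightarrow> 'a \<Rightarrow> 'a" where
  "qm_join S \<equiv> join (qm_order S)"

abbreviation qm_zero :: "('a, 'b) qmspace_scheme \<Rightarrow> 'a" where
  "qm_zero S \<equiv> bottom (qm_order S)"

locale Lqm_object = gen_quasimetric S for S :: "('a, 'b) qmspace_scheme" +
  assumes join_semilattice: "upper_semilattice (qm_order S)"
    and has_bottom: "weak_partial_order_bottom (qm_order S)"
    and QM3: "\<lbrakk>x \<in> carrier S; y \<in> carrier S\<rbrakk> \<Longrightarrow> qdist S x y = qdist S x (qm_join S x y)"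

locale Lqm_morphism = dom: Lqm_object S + cod: Lqm_object S'
  for S :: "('a, 'b) qmspace_scheme" and S' :: "('c, 'd) qmspace_scheme" +
  fixes \<phi> :: "'a \<Rightarrow> 'c"
  assumes map_carrier: "\<phi> \<in> carrier S \<rightarrow> carrier S'"
    and map_join: "\<lbrakk>x \<in> carrier S; y \<in> carrier S\<rbrakk> \<Longrightarrow>
      \<phi> (qm_join S x y) = qm_join S' (\<phi> x) (\<phi> y)"
    and map_zero: "\<phi> (qm_zero S) = qm_zero S'"
    and contractive: "\<lbrakk>x \<in> carrier S; y \<in> carrier S\<rbrakk> \<Longrightarrow>
      qdist S' (\<phi> x) (\<phi> y) \<le> qdist S x y"

abbreviation Lqm_flow :: "('a, 'b) qmspace_scheme \<Rightarrow> ('a \<Rightarrow> 'a) \<Rightarrow> bool" where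
  "Lqm_flow S \<phi> \<equiv> Lqm_morphism S S \<phi>"


section \<open>Intrinsic entropy of a flow of quasimetric semilattices\<close>

definition inert_elements :: "('a, 'b) qmspace_scheme \<Rightarrow> ('a \<Rightarrow> 'a) \<Rightarrow> 'a set" where
  "inert_elements S \<phi> = {x \<in> carrier S. qdist S x (\<phi> x) < \<infinity>}"

text \<open>The value at \<open>n = 0\<close> (the empty join) does not affect the limits below.\<close>

primrec qm_trajectory :: "('a, 'b) qmspace_scheme \<Rightarrow> ('a \<Rightarrow> 'a) \<Rightarrow> 'a \<Rightarrow> nat \<Rightarrow> 'a" where
  "qm_trajectory S \<phi> x 0 = qm_zero S"
| "qm_trajectory S \<phi> x (Suc n) = qm_join S (qm_trajectory S \<phi> x n) ((\<phi> ^^ n) x)"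

definition qm_entropy_at :: "('a, 'b) qmspace_scheme \<Rightarrow> ('a \<Rightarrow> 'a) \<Rightarrow> 'a \<Rightarrow> ennreal" where
  "qm_entropy_at S \<phi> x = lim (\<lambda>n. qdist S x (qm_trajectory S \<phi> x n) / of_nat n)"

definition qm_entropy :: "('a, 'b) qmspace_scheme \<Rightarrow> ('a \<Rightarrow> 'a) \<Rightarrow> ennreal" where
  "qm_entropy S \<phi> = (SUP x\<in>inert_elements S \<phi>. qm_entropy_at S \<phi> x)"


section \<open>The functor of subgroups\<close>

text \<open>Abelian groups are written multiplicatively, so \<open>H + H'\<close> becomes \<open>H <#> H'\<close>, and
  the quotient \<open>K/H\<close> of a subgroup \<open>K\<close> containing \<open>H\<close> is \<open>G\<lparr>carrier := K\<rparr> Mod H\<close>.\<close>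

definition dist_index :: "('a, 'b) monoid_scheme \<Rightarrow> 'a set \<Rightarrow> 'a set \<Rightarrow> ennreal" where
  "dist_index G H H' =
     (let cosets = rcosets\<^bsub>G\<lparr>carrier := H <#>\<^bsub>G\<^esub> H'\<rparr>\<^esub> H
      in if finite cosets then ennreal (ln (real (card cosets))) else \<infinity>)"

definition subgroup_semilattice :: "('a, 'b) monoid_scheme \<Rightarrow> 'a set qmspace" where
  "subgroup_semilattice G = \<lparr>carrier = {H. subgroup H G}, qdist = dist_index G\<rparr>"

definition subgroup_map :: "('a \<Rightarrow> 'c) \<Rightarrow> 'a set \<Rightarrow> 'c set" where
  "subgroup_map f H = f ` H"


section \<open>Intrinsic algebraic entropy\<close>

definition inert_subgroups :: "('a, 'b) monoid_scheme \<Rightarrow> ('a \<Rightarrow> 'a) \<Rightarrow> 'a set set" where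
  "inert_subgroups G f =
     {H. subgroup H G \<and> finite (carrier (G\<lparr>carrier := H <#>\<^bsub>G\<^esub> f ` H\<rparr> Mod H))}"

primrec subgroup_trajectory ::
    "('a, 'b) monoid_scheme \<Rightarrow> ('a \<Rightarrow> 'a) \<Rightarrow> 'a set \<Rightarrow> nat \<Rightarrow> 'a set" where
  "subgroup_trajectory G f H 0 = {\<one>\<^bsub>G\<^esub>}"
| "subgroup_trajectory G f H (Suc n) = subgroup_trajectory G f H n <#>\<^bsub>G\<^esub> (f ^^ n) ` H"

definition intrinsic_ent_at :: "('a, 'b) monoid_scheme \<Rightarrow> ('a \<Rightarrow> 'a) \<Rightarrow> 'a set \<Rightarrow> real" where
  "intrinsic_ent_at G f H =
     lim (\<lambda>n. 1 / real n *
       ln (real (order (G\<lparr>carrier := subgroup_trajectory G f H n\<rparr> Mod H))))"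

definition intrinsic_ent :: "('a, 'b) monoid_scheme \<Rightarrow> ('a \<Rightarrow> 'a) \<Rightarrow> ennreal" where
  "intrinsic_ent G f = (SUP H\<in>inert_subgroups G f. ennreal (intrinsic_ent_at G f H))"


section \<open>Well-definedness of the functor of subgroups\<close>

context comm_group
begin

lemma dist_index_alt:
  assumes H: "subgroup H G" and K: "subgroup K G"
  shows "dist_index G H K = (if finite ((#>) H ` K)
    then ennreal (ln (real (card ((#>) H ` K)))) else \<infinity>)"
proof -
  have hk: "H #> (h \<otimes> k) = H #> k" if "h \<in> H" "k \<in> K" for h k
    using that H K subgroup.mem_carrier[OF K] subgroup.mem_carrier[OF H]
    by (metis coset_join2 coset_mult_assoc subgroup.subset)
  have "rcosets\<^bsub>G\<lparr>carrier := H <#> K\<rparr>\<^esub> H = (#>) H ` (H <#> K)"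
    by (auto simp: RCOSETS_def r_coset_def)
  also have "\<dots> = (#>) H ` K"
  proof
    show "(#>) H ` (H <#> K) \<subseteq> (#>) H ` K"
      by (auto simp: set_mult_def hk)
    show "(#>) H ` K \<subseteq> (#>) H ` (H <#> K)"
    proof
      fix c assume "c \<in> (#>) H ` K"
      then obtain k where k: "k \<in> K" "c = H #> k" by auto
      have "\<one> \<otimes> k \<in> H <#> K"
        using k subgroup.one_closed[OF H] by (auto simp: set_mult_def)
      then show "c \<in> (#>) H ` (H <#> K)"
        using k subgroup.mem_carrier[OF K] by auto
    qed
  qed
  finally show ?thesis by (simp add: dist_index_def)
qed

lemma dist_index_eq_0_iff:
  assumes H: "subgroup H G" and K: "subgroup K G"
  shows "dist_index G H K = 0 \<longleftrightarrow> K \<subseteq> H"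
proof
  have H0: "H \<in> (#>) H ` K"
    using subgroup.one_closed[OF K] subgroup.subset[OF H] by (metis coset_mult_one image_eqI)
  assume "dist_index G H K = 0"
  then have fin: "finite ((#>) H ` K)" and "ln (real (card ((#>) H ` K))) \<le> 0"
    using H K by (auto simp: dist_index_alt ennreal_eq_0_iff split: if_splits)
  moreover have "card ((#>) H ` K) > 0" using fin H0 by (metis card_gt_0_iff empty_iff)
  ultimately have "card ((#>) H ` K) = 1" by simp
  then have eq: "(#>) H ` K = {H}" using H0 by (metis card_1_singletonE singletonD)
  show "K \<subseteq> H"
  proof
    fix k assume k: "k \<in> K"
    then have "H #> k = H" using eq by blast
    then show "k \<in> H"
      using k H subgroup.mem_carrier[OF K] by (metis coset_join1 subgroup.subset)
  qed
next
  assume "K \<subseteq> H"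
  then have "(#>) H ` K = {H}"
    using subgroup.one_closed[OF K] subgroup.mem_carrier[OF H] H
    by (auto simp: coset_join2 subset_iff image_iff intro!: bexI[of _ "\<one>"])
  then show "dist_index G H K = 0" using H K by (simp add: dist_index_alt)
qed

lemma dist_index_triangle:
  assumes H: "subgroup H G" and K: "subgroup K G" and L: "subgroup L G"
  shows "dist_index G H L \<le> dist_index G H K + dist_index G K L"
proof (cases "finite ((#>) H ` K) \<and> finite ((#>) K ` L)")
  case False
  then show ?thesis using H K L by (auto simp: dist_index_alt)
next
  case True
  let ?A = "(#>) H ` K" and ?C = "(#>) K ` L"
  have "\<forall>c\<in>?C. \<exists>l. l \<in> L \<and> c = K #> l" by auto
  then obtain r where r: "\<And>c. c \<in> ?C \<Longrightarrow> r c \<in> L \<and> c = K #> r c" by metis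
  have sub: "(#>) H ` L \<subseteq> (\<lambda>(a, c). a #> r c) ` (?A \<times> ?C)"
  proof
    fix S assume "S \<in> (#>) H ` L"
    then obtain l where l: "l \<in> L" "S = H #> l" by auto
    let ?c = "K #> l"
    have c: "?c \<in> ?C" using l by auto
    have lc: "l \<in> carrier G" using l subgroup.mem_carrier[OF L] by auto
    have rc: "r ?c \<in> carrier G" using r[OF c] subgroup.mem_carrier[OF L] by auto
    have "l \<in> K #> l" using rcos_self[OF lc K] .
    then have "l \<in> K #> r ?c" using r[OF c] by auto
    then obtain k where k: "k \<in> K" "l = k \<otimes> r ?c" by (auto simp: r_coset_def)
    have "S = (H #> k) #> r ?c"
      using k l rc subgroup.mem_carrier[OF K] subgroup.subset[OF H]
      by (simp add: coset_mult_assoc)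
    then show "S \<in> (\<lambda>(a, c). a #> r c) ` (?A \<times> ?C)" using k c by force
  qed
  have fin: "finite (?A \<times> ?C)" using True by auto
  have finL: "finite ((#>) H ` L)" using finite_subset[OF sub] fin by blast
  have ne: "K \<noteq> {}" "L \<noteq> {}" using K L subgroup.one_closed by blast+
  have pos: "card ?A > 0" "card ?C > 0" "card ((#>) H ` L) > 0"
    using True finL ne by (auto simp: card_gt_0_iff)
  have "card ((#>) H ` L) \<le> card (?A \<times> ?C)"
    by (rule order_trans[OF card_mono[OF _ sub] card_image_le]) (use fin in auto)
  then have "card ((#>) H ` L) \<le> card ?A * card ?C" by (simp add: card_cartesian_product)
  then have "real (card ((#>) H ` L)) \<le> real (card ?A) * real (card ?C)"
    by (metis of_nat_le_iff of_nat_mult)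
  then have "ln (real (card ((#>) H ` L))) \<le> ln (real (card ?A) * real (card ?C))"
    using pos by simp
  also have "\<dots> = ln (real (card ?A)) + ln (real (card ?C))"
    using pos by (simp add: ln_mult)
  finally have "ennreal (ln (real (card ((#>) H ` L))))
      \<le> ennreal (ln (real (card ?A)) + ln (real (card ?C)))"
    by (rule ennreal_leI)
  also have "\<dots> = ennreal (ln (real (card ?A))) + ennreal (ln (real (card ?C)))"
    using pos by (intro ennreal_plus) (auto simp: Suc_leI)
  finally show ?thesis using H K L True finL by (simp add: dist_index_alt)
qed

lemma subgroup_set_mult:
  assumes "subgroup H G" "subgroup K G"
  shows "subgroup (H <#> K) G"
  using assms by (metis mult_subgroups)

lemma set_mult_least:
  assumes H: "subgroup H G" and K: "subgroup K G"
  shows "H \<subseteq> H <#> K" "K \<subseteq> H <#> K"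
    "\<lbrakk>subgroup L G; H \<subseteq> L; K \<subseteq> L\<rbrakk> \<Longrightarrow> H <#> K \<subseteq> L"
proof -
  show "H \<subseteq> H <#> K"
    using subgroup.one_closed[OF K] subgroup.mem_carrier[OF H] unfolding set_mult_def by force
  show "K \<subseteq> H <#> K"
    using subgroup.one_closed[OF H] subgroup.mem_carrier[OF K] unfolding set_mult_def by force
  show "\<lbrakk>subgroup L G; H \<subseteq> L; K \<subseteq> L\<rbrakk> \<Longrightarrow> H <#> K \<subseteq> L"
    by (auto simp: set_mult_def subset_iff subgroup.m_closed)
qed

lemma subgroup_semilattice_le_iff:
  assumes "subgroup H G" "subgroup K G"
  shows "le (qm_order (subgroup_semilattice G)) H K \<longleftrightarrow> H \<subseteq> K"
  using assms by (simp add: qm_order_def subgroup_semilattice_def dist_index_eq_0_iff)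

lemma subgroup_semilattice_partial_order:
  "partial_order (qm_order (subgroup_semilattice G))"
  by unfold_locales
    (auto simp: qm_order_def subgroup_semilattice_def dist_index_eq_0_iff)

lemma subgroup_semilattice_least_join:
  assumes H: "subgroup H G" and K: "subgroup K G"
  shows "least (qm_order (subgroup_semilattice G)) (H <#> K)
    (Upper (qm_order (subgroup_semilattice G)) {H, K})"
proof (rule least_UpperI)
  have carr: "carrier (qm_order (subgroup_semilattice G)) = {L. subgroup L G}"
    by (simp add: qm_order_def subgroup_semilattice_def)
  show "{H, K} \<subseteq> carrier (qm_order (subgroup_semilattice G))"
    "H <#> K \<in> carrier (qm_order (subgroup_semilattice G))"
    using H K subgroup_set_mult[OF H K] by (simp_all add: carr)
  show "le (qm_order (subgroup_semilattice G)) L (H <#> K)" if "L \<in> {H, K}" for L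
    using that H K subgroup_set_mult[OF H K] set_mult_least(1,2)[OF H K]
    by (auto simp: subgroup_semilattice_le_iff)
  show "le (qm_order (subgroup_semilattice G)) (H <#> K) L"
    if "L \<in> Upper (qm_order (subgroup_semilattice G)) {H, K}" for L
  proof -
    have L1: "subgroup L G"
      using that by (simp add: Upper_def carr)
    have "le (qm_order (subgroup_semilattice G)) H L"
      using that H unfolding Upper_def carr by blast
    moreover have "le (qm_order (subgroup_semilattice G)) K L"
      using that K unfolding Upper_def carr by blast
    ultimately have L: "subgroup L G" "H \<subseteq> L" "K \<subseteq> L"
      using L1 H K by (simp_all add: subgroup_semilattice_le_iff)
    then show ?thesis
      using subgroup_set_mult[OF H K] set_mult_least(3)[OF H K]
      by (simp add: subgroup_semilattice_le_iff)
  qed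
qed

lemma subgroup_semilattice_join:
  assumes "subgroup H G" "subgroup K G"
  shows "qm_join (subgroup_semilattice G) H K = H <#> K"
proof -
  interpret P: partial_order "qm_order (subgroup_semilattice G)"
    by (rule subgroup_semilattice_partial_order)
  show ?thesis
    unfolding join_def sup_def
  proof (rule some_equality)
    show "least (qm_order (subgroup_semilattice G)) (H <#> K)
        (Upper (qm_order (subgroup_semilattice G)) {H, K})"
      by (rule subgroup_semilattice_least_join[OF assms])
    then show "L = H <#> K" if "least (qm_order (subgroup_semilattice G)) L
        (Upper (qm_order (subgroup_semilattice G)) {H, K})" for L
      using that P.least_unique by blast
  qed
qed

lemma subgroup_semilattice_least_trivial:
  "least (qm_order (subgroup_semilattice G)) {\<one>} (carrier (qm_order (subgroup_semilattice G)))"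
proof -
  have carr: "carrier (qm_order (subgroup_semilattice G)) = {L. subgroup L G}"
    by (simp add: qm_order_def subgroup_semilattice_def)
  have "le (qm_order (subgroup_semilattice G)) {\<one>} L" if "subgroup L G" for L
    using that triv_subgroup subgroup.one_closed[OF that]
    by (simp add: subgroup_semilattice_le_iff)
  then show ?thesis using triv_subgroup by (simp add: least_def carr)
qed

lemma subgroup_semilattice_zero: "qm_zero (subgroup_semilattice G) = {\<one>}"
proof -
  interpret P: partial_order "qm_order (subgroup_semilattice G)"
    by (rule subgroup_semilattice_partial_order)
  show ?thesis
    unfolding bottom_def
  proof (rule some_equality)
    show "least (qm_order (subgroup_semilattice G)) {\<one>}
        (carrier (qm_order (subgroup_semilattice G)))"
      by (rule subgroup_semilattice_least_trivial)
    then show "L = {\<one>}" if "least (qm_order (subgroup_semilattice G)) L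
        (carrier (qm_order (subgroup_semilattice G)))" for L
      using that P.least_unique by blast
  qed
qed

lemma Lqm_object_subgroup_semilattice: "Lqm_object (subgroup_semilattice G)"
proof (intro Lqm_object.intro gen_quasimetric.intro Lqm_object_axioms.intro)
  show "carrier (subgroup_semilattice G) \<noteq> {}"
    using triv_subgroup by (auto simp: subgroup_semilattice_def)
  show "upper_semilattice (qm_order (subgroup_semilattice G))"
  proof -
    interpret P: partial_order "qm_order (subgroup_semilattice G)"
      by (rule subgroup_semilattice_partial_order)
    show ?thesis
    proof unfold_locales
      fix H K assume "H \<in> carrier (qm_order (subgroup_semilattice G))"
        "K \<in> carrier (qm_order (subgroup_semilattice G))"
      then have "subgroup H G" "subgroup K G"
        by (auto simp: qm_order_def subgroup_semilattice_def)
      from subgroup_semilattice_least_join[OF this]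
      show "\<exists>s. least (qm_order (subgroup_semilattice G)) s
        (Upper (qm_order (subgroup_semilattice G)) {H, K})" by blast
    qed
  qed
  show "weak_partial_order_bottom (qm_order (subgroup_semilattice G))"
  proof -
    interpret P: partial_order "qm_order (subgroup_semilattice G)"
      by (rule subgroup_semilattice_partial_order)
    show ?thesis
      by unfold_locales (use subgroup_semilattice_least_trivial in blast)
  qed
next
  fix H K assume "H \<in> carrier (subgroup_semilattice G)" "K \<in> carrier (subgroup_semilattice G)"
  then have HK: "subgroup H G" "subgroup K G" by (auto simp: subgroup_semilattice_def)
  then show "(qdist (subgroup_semilattice G) H K = 0 \<and> qdist (subgroup_semilattice G) K H = 0)
      \<longleftrightarrow> H = K"
    by (auto simp: subgroup_semilattice_def dist_index_eq_0_iff)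
  have "H <#> (H <#> K) = H <#> K"
    using HK by (metis set_mult_assoc subgroup.subset subgroup_mult_id)
  then show "qdist (subgroup_semilattice G) H K
      = qdist (subgroup_semilattice G) H (qm_join (subgroup_semilattice G) H K)"
    by (simp add: subgroup_semilattice_join[OF HK])
      (simp add: subgroup_semilattice_def dist_index_def)
  fix L assume "L \<in> carrier (subgroup_semilattice G)"
  then show "qdist (subgroup_semilattice G) H L
      \<le> qdist (subgroup_semilattice G) H K + qdist (subgroup_semilattice G) K L"
    using HK by (simp add: subgroup_semilattice_def dist_index_triangle)
qed

end

lemma dist_index_hom_le:
  assumes G: "comm_group G" and G': "comm_group G'" and f: "f \<in> hom G G'"
    and H: "subgroup H G" and K: "subgroup K G"
  shows "dist_index G' (f ` H) (f ` K) \<le> dist_index G H K"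
proof -
  interpret G: comm_group G by (rule G)
  interpret G': comm_group G' by (rule G')
  interpret group_hom G G' f by unfold_locales (rule f)
  let ?A = "(#>\<^bsub>G\<^esub>) H ` K" and ?B = "(#>\<^bsub>G'\<^esub>) (f ` H) ` f ` K"
  have HK': "subgroup (f ` H) G'" "subgroup (f ` K) G'"
    using H K by (simp_all add: subgroup_img_is_subgroup)
  have coset: "f ` (H #>\<^bsub>G\<^esub> k) = f ` H #>\<^bsub>G'\<^esub> f k" if "k \<in> K" for k
  proof -
    have "f (h \<otimes>\<^bsub>G\<^esub> k) = f h \<otimes>\<^bsub>G'\<^esub> f k" if "h \<in> H" for h
      using that \<open>k \<in> K\<close> subgroup.mem_carrier[OF H] subgroup.mem_carrier[OF K] by simp
    then show ?thesis by (auto simp: r_coset_def image_UN)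
  qed
  have eq: "?B = image f ` ?A" by (auto simp: coset image_iff)
  show ?thesis
  proof (cases "finite ?A")
    case True
    have "card ?B > 0"
      using True K subgroup.one_closed by (fastforce simp: card_gt_0_iff eq)
    moreover have "card ?B \<le> card ?A" unfolding eq by (rule card_image_le[OF True])
    ultimately have "ln (real (card ?B)) \<le> ln (real (card ?A))" by simp
    moreover have "finite ?B" using True eq by simp
    ultimately show ?thesis
      using True G.dist_index_alt[OF H K] G'.dist_index_alt[OF HK'] by (simp add: ennreal_leI)
  qed (use G.dist_index_alt[OF H K] in auto)
qed

lemma Lqm_morphism_subgroup_map:
  assumes G: "comm_group G" and G': "comm_group G'" and f: "f \<in> hom G G'"
  shows "Lqm_morphism (subgroup_semilattice G) (subgroup_semilattice G') (subgroup_map f)"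
proof -
  interpret G: comm_group G by (rule G)
  interpret G': comm_group G' by (rule G')
  interpret group_hom G G' f by unfold_locales (rule f)
  interpret dom: Lqm_object "subgroup_semilattice G"
    by (rule G.Lqm_object_subgroup_semilattice)
  interpret cod: Lqm_object "subgroup_semilattice G'"
    by (rule G'.Lqm_object_subgroup_semilattice)
  show ?thesis
  proof unfold_locales
    show "subgroup_map f \<in> carrier (subgroup_semilattice G) \<rightarrow> carrier (subgroup_semilattice G')"
      by (auto simp: subgroup_semilattice_def subgroup_map_def subgroup_img_is_subgroup)
    show "subgroup_map f (qm_zero (subgroup_semilattice G)) = qm_zero (subgroup_semilattice G')"
      by (simp add: G.subgroup_semilattice_zero G'.subgroup_semilattice_zero subgroup_map_def)
  next
    fix H K
    assume "H \<in> carrier (subgroup_semilattice G)" "K \<in> carrier (subgroup_semilattice G)"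
    then have HK: "subgroup H G" "subgroup K G" by (auto simp: subgroup_semilattice_def)
    have "f ` (H <#>\<^bsub>G\<^esub> K) = f ` H <#>\<^bsub>G'\<^esub> f ` K"
      using HK f by (metis set_mult_hom subgroup.subset)
    then show "subgroup_map f (qm_join (subgroup_semilattice G) H K)
      = qm_join (subgroup_semilattice G') (subgroup_map f H) (subgroup_map f K)"
      using HK by (simp add: G.subgroup_semilattice_join G'.subgroup_semilattice_join
          subgroup_map_def subgroup_img_is_subgroup)
    show "qdist (subgroup_semilattice G') (subgroup_map f H) (subgroup_map f K)
      \<le> qdist (subgroup_semilattice G) H K"
      using dist_index_hom_le[OF G G' f HK]
      by (simp add: subgroup_semilattice_def subgroup_map_def)
  qed
qed

end

theory Submission
  imports Defs
begin

text \<open>The two entropies are suprema over the same family of subgroups: \<open>H\<close> has finite index in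
  \<open>H <#> f ` H\<close> exactly when the quasimetric distance from \<open>H\<close> to \<open>f ` H\<close> is finite
  (\<open>inert_elements_subgroups\<close>). For such an \<open>H\<close> they are limits of the same sequence: joins in
  the semilattice of subgroups are products, so the two notions of trajectory agree
  (\<open>qm_trajectory_subgroup\<close>), and from \<open>n = 1\<close> on the trajectory \<open>T\<^sub>n\<close> contains \<open>H\<close>, so that
  the distance from \<open>H\<close> to \<open>T\<^sub>n\<close> is the logarithm of the order of \<open>T\<^sub>n / H\<close>
  (\<open>dist_index_eq_ln_order\<close>).

  One limit is taken in the reals, the other in the extended nonnegative reals. The operator
  \<open>lim\<close> is only meaningful on convergent sequences, so the comparison needs that the limits exist
  and are finite. This holds for an inert element \<open>x\<close> of any flow of quasimetric
  semilattices (\<open>qm_entropy_limit\<close>), by Fekete's argument. Joining with a fixed element and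
  applying \<open>\<phi>\<close> are both contractions, and \<open>T\<^bsub>m+n+1\<^esub> = T\<^sub>m + \<phi>\<^sup>m(T\<^bsub>n+1\<^esub>)\<close> while
  \<open>T\<^bsub>m+1\<^esub> = T\<^sub>m + \<phi>\<^sup>m(x)\<close>. Hence the distance from \<open>T\<^bsub>m+1\<^esub>\<close> to \<open>T\<^bsub>m+n+1\<^esub>\<close> is at most that
  from \<open>x\<close> to \<open>T\<^bsub>n+1\<^esub>\<close>, and the triangle inequality makes \<open>n \<mapsto> d(x, T\<^bsub>n+1\<^esub>)\<close>
  subadditive. Its value at \<open>1\<close> is \<open>d(x, \<phi>(x))\<close>, so inertness makes all its values finite.\<close>

section \<open>Limits of subadditive sequences\<close>

lemma subadditive_block_bound:
  fixes u :: "nat \<Rightarrow> real"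
  assumes "\<And>m n. u (m + n) \<le> u m + u n" and "u 0 = 0"
  shows "u (k * m) \<le> real k * u m"
proof (induction k)
  case (Suc k)
  then show ?case using assms(1)[of m "k * m"] by (simp add: algebra_simps)
qed (simp add: assms)

text \<open>Fekete's lemma. The limit is the infimum \<open>L\<close> because one good quotient controls all later
  ones: if \<open>u m / m\<close> is close to \<open>L\<close>, division of \<open>n\<close> by \<open>m\<close> with remainder bounds \<open>u n\<close> by
  \<open>n\<close> times that quotient plus a constant.\<close>

lemma subadditive_quotient_tendsto:
  fixes u :: "nat \<Rightarrow> real"
  assumes sub: "\<And>m n. u (m + n) \<le> u m + u n" and zero: "u 0 = 0" and nonneg: "\<And>n. 0 \<le> u n"
  shows "(\<lambda>n. u n / real n) \<longlonglongrightarrow> (INF n\<in>{1..}. u n / real n)"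
proof (rule LIMSEQ_I)
  define L where "L = (INF n\<in>{1..}. u n / real n)"
  have bdd: "bdd_below ((\<lambda>n. u n / real n) ` {1..})"
    by (rule bdd_belowI[of _ 0]) (auto simp: nonneg)
  fix e :: real assume e: "0 < e"
  have "\<exists>m\<in>{1..}. u m / real m < L + e / 2"
    using cINF_less_iff[OF _ bdd, of "L + e / 2"] e unfolding L_def by auto
  then obtain m where m: "m \<ge> 1" "u m / real m < L + e / 2" by auto
  \<comment> \<open>From \<open>N\<close> on, the contribution of the remainder, at most \<open>m * u 1\<close>, is below \<open>e / 2\<close>
    after division by \<open>n\<close>.\<close>
  obtain N where N: "real N > real m * u 1 / (e / 2)"
    using reals_Archimedean2 by blast
  have "norm (u n / real n - L) < e" if n: "n \<ge> max 1 N" for n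
  proof -
    have n1: "n \<ge> 1" "real n \<ge> real N" using n by auto
    have "u n = u (n div m * m + n mod m)" by simp
    also have "\<dots> \<le> u (n div m * m) + u (n mod m * 1)"
      using sub[of "n div m * m" "n mod m"] by simp
    also have "\<dots> \<le> real (n div m) * u m + real (n mod m) * u 1"
      by (intro add_mono subadditive_block_bound sub zero)
    also have "real (n mod m) * u 1 \<le> real m * u 1"
      using m nonneg by (intro mult_right_mono) (auto intro: less_imp_le)
    also have "real (n div m) * u m = real (n div m * m) * (u m / real m)"
      using m by simp
    also have "\<dots> \<le> real n * (u m / real m)"
      using m nonneg
      by (intro mult_right_mono) (simp_all only: of_nat_le_iff div_times_less_eq_dividend
          divide_nonneg_nonneg of_nat_0_le_iff)
    finally have "u n \<le> real n * (u m / real m) + real m * u 1" by simp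
    then have "u n / real n \<le> u m / real m + real m * u 1 / real n"
      using n1 by (simp add: field_simps)
    moreover have "real m * u 1 / real n < e / 2"
    proof -
      have "real m * u 1 < real N * (e / 2)" using N e by (simp add: field_simps)
      also have "\<dots> \<le> real n * (e / 2)" using n1 e by (intro mult_right_mono) auto
      finally show ?thesis using n1 by (simp add: field_simps)
    qed
    moreover have "L \<le> u n / real n"
      unfolding L_def using n1 by (intro cINF_lower bdd) auto
    ultimately show ?thesis unfolding real_norm_def using m(2) by linarith
  qed
  then show "\<exists>n0. \<forall>n\<ge>n0. norm (u n / real n - (INF n\<in>{1..}. u n / real n)) < e"
    unfolding L_def by blast
qed


section \<open>Joins in quasimetric semilattices\<close>

context Lqm_object
begin

interpretation L: upper_semilattice "qm_order S"
  by (rule join_semilattice)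

interpretation B: weak_partial_order_bottom "qm_order S"
  by (rule has_bottom)

lemma qm_order_simps [simp]:
  "carrier (qm_order S) = carrier S" "eq (qm_order S) = (=)"
  "le (qm_order S) x y \<longleftrightarrow> qdist S y x = 0"
  by (simp_all add: qm_order_def)

lemma qm_join_closed [simp]: "\<lbrakk>x \<in> carrier S; y \<in> carrier S\<rbrakk> \<Longrightarrow> qm_join S x y \<in> carrier S"
  using L.join_closed by simp

lemma qm_zero_closed [simp]: "qm_zero S \<in> carrier S"
  using B.bottom_closed by simp

lemma qm_join_assoc:
  "\<lbrakk>x \<in> carrier S; y \<in> carrier S; z \<in> carrier S\<rbrakk> \<Longrightarrow>
    qm_join S (qm_join S x y) z = qm_join S x (qm_join S y z)"
  using L.weak_join_assoc[of x y z] by simp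

lemma qm_join_absorb:
  assumes "x \<in> carrier S" "y \<in> carrier S" "qdist S x y = 0"
  shows "qm_join S x y = x"
  using assms QM1[of x "qm_join S x y"] QM3[of x y] L.join_left[of x y] by simp

lemma qm_join_commute: "qm_join S x y = qm_join S y x"
  by (rule join_comm)

lemma qm_join_zero [simp]: "x \<in> carrier S \<Longrightarrow> qm_join S x (qm_zero S) = x"
  using B.bottom_lower[of x] by (simp add: qm_join_absorb)

text \<open>The distance is antitone in its first argument, because a larger element is at distance
  \<open>0\<close> from a smaller one.\<close>

lemma qdist_join_left_le:
  assumes "x \<in> carrier S" "y \<in> carrier S" "z \<in> carrier S"
  shows "qdist S (qm_join S x y) z \<le> qdist S y z"
  using assms QM2[of "qm_join S x y" y z] L.join_right[of x y] by simp

text \<open>Joining with a fixed element is a contraction. By QM3 the second \<open>x\<close> can be dropped, as it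
  is absorbed by the first, and what is left is antitonicity in the first argument.\<close>

lemma qdist_join_join_le:
  assumes x: "x \<in> carrier S" and y: "y \<in> carrier S" and z: "z \<in> carrier S"
  shows "qdist S (qm_join S x y) (qm_join S x z) \<le> qdist S y z"
proof -
  have "qm_join S (qm_join S x y) (qm_join S x z) = qm_join S (qm_join S (qm_join S x y) x) z"
    using x y z by (simp add: qm_join_assoc)
  also have "qm_join S (qm_join S x y) x = qm_join S x y"
    using x y L.join_left[of x y] by (simp add: qm_join_absorb)
  finally have "qdist S (qm_join S x y) (qm_join S x z) = qdist S (qm_join S x y) z"
    using x y z QM3[of "qm_join S x y" "qm_join S x z"] QM3[of "qm_join S x y" z] by simp
  then show ?thesis using qdist_join_left_le[OF x y z] by simp
qed

end


section \<open>Trajectories and the existence of the entropy of an inert element\<close>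

lemma Lqm_flow_funpow:
  assumes "Lqm_flow S \<phi>"
  shows "Lqm_flow S (\<phi> ^^ n)"
proof -
  interpret Lqm_morphism S S \<phi> by (rule assms)
  show ?thesis
  proof (induction n)
    case 0
    show ?case by unfold_locales auto
  next
    case (Suc n)
    interpret N: Lqm_morphism S S "\<phi> ^^ n" by (rule Suc)
    show ?case
    proof unfold_locales
      show "\<phi> ^^ Suc n \<in> carrier S \<rightarrow> carrier S"
        using map_carrier N.map_carrier by auto
      show "(\<phi> ^^ Suc n) (qm_zero S) = qm_zero S"
        by (simp add: N.map_zero map_zero)
      fix x y assume xy: "x \<in> carrier S" "y \<in> carrier S"
      then have n: "(\<phi> ^^ n) x \<in> carrier S" "(\<phi> ^^ n) y \<in> carrier S"
        using N.map_carrier by auto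
      show "(\<phi> ^^ Suc n) (qm_join S x y) = qm_join S ((\<phi> ^^ Suc n) x) ((\<phi> ^^ Suc n) y)"
        using xy n by (simp add: N.map_join map_join)
      show "qdist S ((\<phi> ^^ Suc n) x) ((\<phi> ^^ Suc n) y) \<le> qdist S x y"
        using N.contractive[OF xy] contractive[OF n] by simp
    qed
  qed
qed

context
  fixes S :: "('a, 'b) qmspace_scheme" and \<phi> :: "'a \<Rightarrow> 'a"
  assumes flow: "Lqm_flow S \<phi>"
begin

interpretation Lqm_morphism S S \<phi> by (rule flow)

lemma iterate_closed [simp]: "x \<in> carrier S \<Longrightarrow> (\<phi> ^^ n) x \<in> carrier S"
  using Lqm_morphism.map_carrier[OF Lqm_flow_funpow[OF flow]] by auto

lemma qm_trajectory_closed [simp]: "x \<in> carrier S \<Longrightarrow> qm_trajectory S \<phi> x n \<in> carrier S"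
  by (induction n) auto

lemma qm_trajectory_add:
  assumes x: "x \<in> carrier S"
  shows "qm_trajectory S \<phi> x (m + n)
    = qm_join S (qm_trajectory S \<phi> x m) ((\<phi> ^^ m) (qm_trajectory S \<phi> x n))"
proof (induction n)
  case 0
  show ?case using x by (simp add: Lqm_morphism.map_zero[OF Lqm_flow_funpow[OF flow]])
next
  case (Suc n)
  then show ?case
    using x by (simp add: Lqm_morphism.map_join[OF Lqm_flow_funpow[OF flow]]
        dom.qm_join_assoc funpow_add)
qed

lemma qm_trajectory_one: "x \<in> carrier S \<Longrightarrow> qm_trajectory S \<phi> x 1 = x"
  by (simp add: dom.qm_join_commute[of "qm_zero S"])

text \<open>Both trajectories in the middle distance start with \<open>T\<^sub>m\<close>; removing this common part and then
  \<open>\<phi>\<^sup>m\<close> can only increase the distance. The shift by one is essential: the overlap of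
  \<open>T\<^bsub>m+1\<^esub>\<close> with the second block is the element \<open>\<phi>\<^sup>m(x)\<close>, from which the distance to that
  block is measured.\<close>

lemma qdist_trajectory_subadditive:
  assumes x: "x \<in> carrier S"
  shows "qdist S x (qm_trajectory S \<phi> x (Suc (m + n)))
    \<le> qdist S x (qm_trajectory S \<phi> x (Suc m)) + qdist S x (qm_trajectory S \<phi> x (Suc n))"
proof -
  let ?T = "qm_trajectory S \<phi> x"
  have "qdist S (?T (Suc m)) (?T (Suc (m + n)))
      = qdist S (qm_join S (?T m) ((\<phi> ^^ m) x)) (qm_join S (?T m) ((\<phi> ^^ m) (?T (Suc n))))"
    using qm_trajectory_add[OF x, of m "Suc n"] by simp
  also have "\<dots> \<le> qdist S ((\<phi> ^^ m) x) ((\<phi> ^^ m) (?T (Suc n)))"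
    by (intro dom.qdist_join_join_le iterate_closed qm_trajectory_closed x)
  also have "\<dots> \<le> qdist S x (?T (Suc n))"
    by (intro Lqm_morphism.contractive[OF Lqm_flow_funpow[OF flow]] qm_trajectory_closed x)
  finally have step: "qdist S (?T (Suc m)) (?T (Suc (m + n))) \<le> qdist S x (?T (Suc n))" .
  have "qdist S x (?T (Suc (m + n)))
      \<le> qdist S x (?T (Suc m)) + qdist S (?T (Suc m)) (?T (Suc (m + n)))"
    by (intro dom.QM2 qm_trajectory_closed x)
  also have "\<dots> \<le> qdist S x (?T (Suc m)) + qdist S x (?T (Suc n))"
    by (intro add_left_mono step)
  finally show ?thesis .
qed

lemma qdist_trajectory_one: "x \<in> carrier S \<Longrightarrow> qdist S x (qm_trajectory S \<phi> x (Suc 0)) = 0"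
  using qm_trajectory_one[of x] dom.QM1[of x x] by simp

lemma qdist_trajectory_finite:
  assumes x: "x \<in> inert_elements S \<phi>"
  shows "qdist S x (qm_trajectory S \<phi> x (Suc n)) < \<infinity>"
proof (induction n)
  case 0
  show ?case using x qdist_trajectory_one[of x] by (simp add: inert_elements_def)
next
  case (Suc n)
  have xS: "x \<in> carrier S" and fin: "qdist S x (\<phi> x) < \<infinity>"
    using x by (auto simp: inert_elements_def)
  have "qm_trajectory S \<phi> x (Suc 1) = qm_join S x (\<phi> x)"
    using qm_trajectory_one[OF xS] by simp
  then have "qdist S x (qm_trajectory S \<phi> x (Suc 1)) = qdist S x (\<phi> x)"
    by (simp only: dom.QM3[OF xS funcset_mem[OF map_carrier xS]])
  with fin Suc have "qdist S x (qm_trajectory S \<phi> x (Suc n))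
      + qdist S x (qm_trajectory S \<phi> x (Suc 1)) < \<infinity>"
    by (simp del: qm_trajectory.simps)
  then show ?case
    using qdist_trajectory_subadditive[OF xS, of n 1]
    by (metis Suc_eq_plus1 order.strict_trans1)
qed

text \<open>The entropy of a flow is a limit of extended reals, that of a group endomorphism a limit of
  reals; comparing them requires the same finite value for both limits.\<close>

lemma qm_entropy_limit:
  assumes x: "x \<in> inert_elements S \<phi>"
  obtains l where "(\<lambda>n. enn2real (qdist S x (qm_trajectory S \<phi> x n)) / real n) \<longlonglongrightarrow> l"
    and "qm_entropy_at S \<phi> x = ennreal l"
proof -
  let ?d = "\<lambda>n. qdist S x (qm_trajectory S \<phi> x n)"
  \<comment> \<open>Fekete's lemma applies to the sequence shifted by one; the quotients by \<open>n\<close> and by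
    \<open>n + 1\<close> have the same limit.\<close>
  define u where "u n = enn2real (?d (Suc n))" for n
  have xS: "x \<in> carrier S" using x by (auto simp: inert_elements_def)
  have fin: "?d (Suc n) < \<infinity>" for n by (rule qdist_trajectory_finite[OF x])
  have u: "ennreal (u n) = ?d (Suc n)" for n
    unfolding u_def using fin[of n] by (intro ennreal_enn2real) simp
  have "u (m + n) \<le> u m + u n" for m n
  proof -
    have "ennreal (u (m + n)) \<le> ennreal (u m) + ennreal (u n)"
      unfolding u by (rule qdist_trajectory_subadditive[OF xS])
    also have "\<dots> = ennreal (u m + u n)" by (rule ennreal_plus[symmetric]) (simp_all add: u_def)
    finally show ?thesis by (subst (asm) ennreal_le_iff) (simp_all add: u_def)
  qed
  moreover have "u 0 = 0" by (simp add: u_def qdist_trajectory_one[OF xS] del: qm_trajectory.simps)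
  ultimately have "(\<lambda>n. u n / real n) \<longlonglongrightarrow> (INF n\<in>{1..}. u n / real n)"
    by (intro subadditive_quotient_tendsto) (auto simp: u_def)
  then obtain l where l: "(\<lambda>n. u n / real n) \<longlonglongrightarrow> l" by blast
  have "(\<lambda>n. u n / real n * (real n / real (Suc n))) \<longlonglongrightarrow> l * 1"
    by (intro tendsto_mult l LIMSEQ_n_over_Suc_n)
  moreover have "\<forall>\<^sub>F n in sequentially. u n / real n * (real n / real (Suc n)) = u n / real (Suc n)"
    using eventually_gt_at_top[of 0] by eventually_elim simp
  ultimately have "(\<lambda>n. u n / real (Suc n)) \<longlonglongrightarrow> l * 1"
    by (rule Lim_transform_eventually)
  then have lim: "(\<lambda>n. enn2real (?d n) / real n) \<longlonglongrightarrow> l"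
    unfolding u_def mult_1_right by (rule LIMSEQ_imp_Suc)
  have "\<forall>\<^sub>F n in sequentially. ennreal (enn2real (?d n) / real n) = ?d n / of_nat n"
    using eventually_gt_at_top[of 0]
  proof eventually_elim
    case (elim n)
    then have "?d n = ennreal (enn2real (?d n))"
      using fin[of "n - 1"] by (intro ennreal_enn2real[symmetric]) simp
    then show ?case
      using elim divide_ennreal[of "enn2real (?d n)" "real n"]
      by (simp add: ennreal_of_nat_eq_real_of_nat)
  qed
  moreover have "(\<lambda>n. ennreal (enn2real (?d n) / real n)) \<longlonglongrightarrow> ennreal l"
    by (intro tendsto_ennrealI lim)
  ultimately have "(\<lambda>n. ?d n / of_nat n) \<longlonglongrightarrow> ennreal l"
    by (rule Lim_transform_eventually[rotated])
  then have "qm_entropy_at S \<phi> x = ennreal l" unfolding qm_entropy_at_def by (rule limI)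
  with lim show thesis by (rule that)
qed

end


section \<open>Flows of subgroups\<close>

lemma subgroup_map_funpow:
  fixes f :: "'a \<Rightarrow> 'a"
  shows "(subgroup_map f ^^ n) H = (f ^^ n) ` H"
  by (induction n) (simp_all add: subgroup_map_def image_image)

context comm_group
begin

lemma qm_trajectory_subgroup:
  assumes f: "f \<in> hom G G" and H: "subgroup H G"
  shows "qm_trajectory (subgroup_semilattice G) (subgroup_map f) H n = subgroup_trajectory G f H n"
proof (induction n)
  case 0
  show ?case by (simp add: subgroup_semilattice_zero)
next
  case (Suc n)
  have flow: "Lqm_flow (subgroup_semilattice G) (subgroup_map f)"
    by (intro Lqm_morphism_subgroup_map f comm_group_axioms)
  have "subgroup (qm_trajectory (subgroup_semilattice G) (subgroup_map f) H n) G"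
    using qm_trajectory_closed[OF flow, of H n] H by (simp add: subgroup_semilattice_def)
  moreover have "subgroup ((subgroup_map f ^^ n) H) G"
    using iterate_closed[OF flow, of H n] H by (simp add: subgroup_semilattice_def)
  ultimately show ?case
    using Suc by (simp add: subgroup_semilattice_join subgroup_map_funpow)
qed

lemma dist_index_eq_ln_order:
  assumes "subgroup H G" "subgroup K G" "H \<subseteq> K" "dist_index G H K < \<infinity>"
  shows "enn2real (dist_index G H K) = ln (real (order (G\<lparr>carrier := K\<rparr> Mod H)))"
proof -
  have "H <#> K = K" using set_mult_least[OF assms(1,2)] assms by blast
  moreover have "0 \<le> ln (real c)" for c :: nat by (cases "c = 0") auto
  ultimately show ?thesis
    using assms(4) by (auto simp: dist_index_def order_def FactGroup_def Let_def split: if_splits)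
qed

lemma inert_elements_subgroups:
  "inert_elements (subgroup_semilattice G) (subgroup_map f) = inert_subgroups G f"
  by (auto simp: inert_elements_def inert_subgroups_def subgroup_semilattice_def
      subgroup_map_def dist_index_def FactGroup_def Let_def)

lemma intrinsic_ent_at_eq:
  assumes f: "f \<in> hom G G" and inert: "H \<in> inert_subgroups G f"
  shows "ennreal (intrinsic_ent_at G f H)
    = qm_entropy_at (subgroup_semilattice G) (subgroup_map f) H"
proof -
  let ?S = "subgroup_semilattice G" and ?\<phi> = "subgroup_map f"
  let ?T = "subgroup_trajectory G f H"
  have flow: "Lqm_flow ?S ?\<phi>" by (intro Lqm_morphism_subgroup_map f comm_group_axioms)
  have inert': "H \<in> inert_elements ?S ?\<phi>" using inert inert_elements_subgroups by simp
  have H: "subgroup H G" using inert by (simp add: inert_subgroups_def)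
  have T: "qm_trajectory ?S ?\<phi> H n = ?T n" for n by (rule qm_trajectory_subgroup[OF f H])
  have Tsub: "subgroup (?T n) G" for n
    using qm_trajectory_closed[OF flow, of H n] H unfolding T by (simp add: subgroup_semilattice_def)
  obtain l where l: "(\<lambda>n. enn2real (qdist ?S H (?T n)) / real n) \<longlonglongrightarrow> l"
    "qm_entropy_at ?S ?\<phi> H = ennreal l"
    using qm_entropy_limit[OF flow inert'] unfolding T by metis
  have "\<forall>\<^sub>F n in sequentially. enn2real (qdist ?S H (?T n)) / real n
      = 1 / real n * ln (real (order (G\<lparr>carrier := ?T n\<rparr> Mod H)))"
    using eventually_gt_at_top[of 0]
  proof eventually_elim
    case (elim n)
    then obtain k where n: "n = Suc k" by (cases n) auto
    \<comment> \<open>At \<open>n = 0\<close> this fails unless \<open>H\<close> is trivial.\<close>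
    have "H \<subseteq> ?T (Suc k)"
    proof (induction k)
      case 0
      have "?T (Suc 0) = {\<one>} <#> H" by simp
      then show ?case using set_mult_least(2)[OF triv_subgroup H] by simp
    next
      case (Suc k)
      have "subgroup ((?\<phi> ^^ Suc k) H) G"
        using iterate_closed[OF flow, of H "Suc k"] H unfolding subgroup_semilattice_def by simp
      then have "?T (Suc k) \<subseteq> ?T (Suc (Suc k))"
        using set_mult_least(1)[OF Tsub[of "Suc k"]]
        unfolding subgroup_map_funpow subgroup_trajectory.simps(2)[of G f H "Suc k"] by blast
      with Suc show ?case by blast
    qed
    moreover have "dist_index G H (?T (Suc k)) < \<infinity>"
      using qdist_trajectory_finite[OF flow inert', of k] unfolding T
      by (simp add: subgroup_semilattice_def)
    ultimately show ?case
      unfolding n using dist_index_eq_ln_order[OF H Tsub[of "Suc k"]]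
      by (simp add: subgroup_semilattice_def del: subgroup_trajectory.simps)
  qed
  from Lim_transform_eventually[OF l(1) this] have "intrinsic_ent_at G f H = l"
    unfolding intrinsic_ent_at_def by (rule limI)
  with l(2) show ?thesis by simp
qed

end

theorem theorem5p2:
  fixes G :: "('a, 'b) monoid_scheme" and f :: "'a \<Rightarrow> 'a"
  assumes "comm_group G" and "f \<in> hom G G"
  shows "intrinsic_ent G f = qm_entropy (subgroup_semilattice G) (subgroup_map f)"
proof -
  interpret comm_group G by (rule assms(1))
  show ?thesis
    unfolding intrinsic_ent_def qm_entropy_def inert_elements_subgroups
    by (intro SUP_cong refl intrinsic_ent_at_eq assms(2))
qed

end
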